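(* The elements of the mean first passage time matrix $M_N=[m_{ij}]$ ($i,j=1,\dots,N$) of a Markov renewal process $\{(X_k^{(N)},T_k^{(N)}),k\ge0\}$ with state space $S_N=\{1,2,\dots,N\}$, irreducible transition matrix $P^{(N)}=[p_{ij}^{(N)}]$ and vector of mean holding times $\boldsymbol{\mu}^{(N)T}=(\mu_1^{(N)},\dots,\mu_N^{(N)})$ can be expressed as follows, in terms of the quantities $p_{ij}^{(n)},\mu_i^{(n)},S(n),q_{ij}^{(t,n)},\nu_i^{(t,n)},R(i,n)$ defined recursively from $P^{(N)}$ and $\boldsymbol{\mu}^{(N)}$: (a) $m_{ij}=\dfrac{\mu_i^{(i)}+\sum_{k=1,k\ne j}^{i-1}p_{ik}^{(i)}m_{kj}}{S(i)}$ for $i=3,\dots,N$; $j=1,\dots,i-1$, with $m_{21}=\dfrac{\mu_2^{(2)}}{S(2)}$. (b) $m_{ii}=\mu_i^{(i)}+\sum_{k=1}^{i-1}p_{ik}^{(i)}m_{ki}$ for $i=2,\dots,N$, with $m_{11}=\mu_1^{(1)}$. (c) $m_{ij}=\dfrac{\nu_i^{(i,j)}+\sum_{k=1}^{i-1}q_{ik}^{(i,j)}m_{kj}}{R(i,j)}$ for $i=2,3,\dots,N-1$; $j=i+1,\dots,N$, with $m_{1j}=\dfrac{\nu_1^{(1,j)}}{R(1,j)}$ for $j=2,3,\dots,N$.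
   Context: A Markov renewal process (MRP) $\{(X_k,T_k),k\ge0\}$, $T_0=0$, on $S_N=\{1,\dots,N\}$ has semi-Markov kernel $Q_{ij}(t)=P\{X_{k+1}=j,T_{k+1}-T_k\le t\mid X_k=i\}$. The embedded Markov chain has transition matrix $P^{(N)}=[p_{ij}^{(N)}]$, $p_{ij}^{(N)}=Q_{ij}(+\infty)$, assumed irreducible; mean holding times $\mu_i^{(N)}=E[T_{k+1}-T_k\mid X_k=i]$ are assumed finite. The mean first passage time $m_{ij}$ is $E[T_\kappa\mid X_0=i]$ with $\kappa=\min\{k\ge1:X_k=j\}$ (the mean recurrence time if $i=j$); these are the unique solution of $m_{ij}=\mu_i^{(N)}+\sum_{k\ne j}p_{ik}^{(N)}m_{kj}$, $1\le i,j\le N$. Recursively defined quantities: for $n=N,N-1,\dots,2$ set $S(n)=\sum_{j=1}^{n-1}p_{nj}^{(n)}=1-p_{nn}^{(n)}$ and $$p_{ij}^{(n-1)}=p_{ij}^{(n)}+\frac{p_{in}^{(n)}p_{nj}^{(n)}}{S(n)},\qquad \mu_i^{(n-1)}=\mu_i^{(n)}+\frac{p_{in}^{(n)}\mu_n^{(n)}}{S(n)},\qquad 1\le i,j\le n-1.$$ For each $n=2,\dots,N$ set $q_{ik}^{(n-1,n)}=p_{ik}^{(n)}$ and $\nu_i^{(n-1,n)}=\mu_i^{(n)}$ for $i,k=1,\dots,n-1$, and for $t=n-1,n-2,\dots,2$, $$q_{ik}^{(t-1,n)}=q_{ik}^{(t,n)}+\frac{q_{it}^{(t,n)}q_{tk}^{(t,n)}}{1-q_{tt}^{(t,n)}},\qquad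 \nu_i^{(t-1,n)}=\nu_i^{(t,n)}+\frac{q_{it}^{(t,n)}\nu_t^{(t,n)}}{1-q_{tt}^{(t,n)}},\qquad i,k=1,\dots,t-1.$$ Finally $R(i,n)=1-q_{ii}^{(i,n)}$ for $i=1,\dots,n-1$, $n=2,\dots,N$. *)

theory Defs
  imports "HOL-Probability.Probability"
begin

text \<open>The sigma-algebra of the history \<open>(X\<^sub>0,T\<^sub>0),\<dots>,(X\<^sub>k,T\<^sub>k)\<close>; states are \<open>{1..N}\<close>.\<close>

definition mrp_history ::
  "'a measure \<Rightarrow> nat \<Rightarrow> (nat \<Rightarrow> 'a \<Rightarrow> nat) \<Rightarrow> (nat \<Rightarrow> 'a \<Rightarrow> real) \<Rightarrow> nat \<Rightarrow> 'a measure" where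
  "mrp_history M N X T k =
     vimage_algebra (space M) (\<lambda>\<omega>. \<lambda>l\<in>{..k}. (X l \<omega>, T l \<omega>))
       (\<Pi>\<^sub>M l\<in>{..k}. count_space {1..N} \<Otimes>\<^sub>M borel)"

text \<open>The last clause is the Markov renewal property: conditionally on the whole history, the
  next state and the holding time are distributed according to the row of the semi-Markov
  kernel \<open>Q\<close> belonging to the current state. The initial distribution is left arbitrary.\<close>

definition markov_renewal_process ::
  "'a measure \<Rightarrow> nat \<Rightarrow> (nat \<Rightarrow> nat \<Rightarrow> real \<Rightarrow> real) \<Rightarrow> (nat \<Rightarrow> 'a \<Rightarrow> nat) \<Rightarrow> (nat \<Rightarrow> 'a \<Rightarrow> real) \<Rightarrow> bool" where
  "markov_renewal_process M N Q X T \<longleftrightarrow>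
     prob_space M \<and>
     (\<forall>k. X k \<in> measurable M (count_space {1..N})) \<and>
     (\<forall>k. T k \<in> borel_measurable M) \<and>
     (AE \<omega> in M. T 0 \<omega> = 0) \<and>
     (\<forall>k. AE \<omega> in M. T k \<omega> \<le> T (Suc k) \<omega>) \<and>
     (\<forall>k. \<forall>j\<in>{1..N}. \<forall>t.
        AE \<omega> in M.
          real_cond_exp M (mrp_history M N X T k)
            (indicator {\<omega>' \<in> space M. X (Suc k) \<omega>' = j \<and> T (Suc k) \<omega>' - T k \<omega>' \<le> t}) \<omega>
          = Q (X k \<omega>) j t)"

definition embedded_transition :: "(nat \<Rightarrow> nat \<Rightarrow> real \<Rightarrow> real) \<Rightarrow> nat \<Rightarrow> nat \<Rightarrow> real" where
  "embedded_transition Q i j = Lim at_top (Q i j)"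

definition irreducible_matrix :: "nat \<Rightarrow> (nat \<Rightarrow> nat \<Rightarrow> real) \<Rightarrow> bool" where
  "irreducible_matrix N p \<longleftrightarrow>
     (\<forall>i\<in>{1..N}. \<forall>j\<in>{1..N}. (i, j) \<in> {(a, b). a \<in> {1..N} \<and> b \<in> {1..N} \<and> p a b > 0}\<^sup>*)"

text \<open>Expectations given an event are integrals with respect to \<^const>\<open>uniform_measure\<close>, i.e. the
  measure conditioned on that event. They are taken in \<^typ>\<open>ennreal\<close>, so that an infinite
  expectation is represented as such.\<close>

text \<open>\<open>E[T\<^bsub>k+1\<^esub> - T\<^sub>k | X\<^sub>k = i]\<close>; by time-homogeneity this does not depend on \<open>k\<close>.\<close>

definition mean_holding_time ::
  "'a measure \<Rightarrow> (nat \<Rightarrow> 'a \<Rightarrow> nat) \<Rightarrow> (nat \<Rightarrow> 'a \<Rightarrow> real) \<Rightarrow> nat \<Rightarrow> nat \<Rightarrow> ennreal" where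
  "mean_holding_time M X T k i =
     (\<integral>\<^sup>+ \<omega>. ennreal (T (Suc k) \<omega> - T k \<omega>) \<partial>uniform_measure M {\<omega> \<in> space M. X k \<omega> = i})"

definition first_passage_time ::
  "(nat \<Rightarrow> 'a \<Rightarrow> nat) \<Rightarrow> (nat \<Rightarrow> 'a \<Rightarrow> real) \<Rightarrow> nat \<Rightarrow> 'a \<Rightarrow> ennreal" where
  "first_passage_time X T j \<omega> =
     (if \<exists>k\<ge>1. X k \<omega> = j then ennreal (T (LEAST k. k \<ge> 1 \<and> X k \<omega> = j) \<omega>) else \<infinity>)"

definition mean_first_passage_time ::
  "'a measure \<Rightarrow> (nat \<Rightarrow> 'a \<Rightarrow> nat) \<Rightarrow> (nat \<Rightarrow> 'a \<Rightarrow> real) \<Rightarrow> nat \<Rightarrow> nat \<Rightarrow> ennreal" where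
  "mean_first_passage_time M X T i j =
     (\<integral>\<^sup>+ \<omega>. first_passage_time X T j \<omega> \<partial>uniform_measure M {\<omega> \<in> space M. X 0 \<omega> = i})"

text \<open>The reduced quantities are defined by downward recursion on the upper index, starting from
  \<open>N\<close> (resp. from \<open>n - 1\<close>). The equations below are those for the passage from index \<open>n + 1\<close> to
  \<open>n\<close> (resp. \<open>t + 1\<close> to \<open>t\<close>). Only the values with \<open>1 \<le> n \<le> N\<close> and \<open>1 \<le> t \<le> n - 1\<close>, and with
  subscripts in \<open>{1..n}\<close> (resp. \<open>{1..t}\<close>), are meaningful.\<close>

text \<open>\<open>red_p p N n i j\<close> is \<open>p\<^sub>i\<^sub>j\<^bsup>(n)\<^esup>\<close>; the denominator is \<open>S(n + 1)\<close>.\<close>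

function red_p :: "(nat \<Rightarrow> nat \<Rightarrow> real) \<Rightarrow> nat \<Rightarrow> nat \<Rightarrow> nat \<Rightarrow> nat \<Rightarrow> real" where
  "red_p p N n i j =
     (if n < N
      then red_p p N (n + 1) i j
           + red_p p N (n + 1) i (n + 1) * red_p p N (n + 1) (n + 1) j
             / (\<Sum>k = 1..n. red_p p N (n + 1) (n + 1) k)
      else p i j)"
  by pat_completeness auto
termination
  by (relation "Wellfounded.measure (\<lambda>(p, N, n, i, j). N - n)") auto

declare red_p.simps [simp del]

definition red_S :: "(nat \<Rightarrow> nat \<Rightarrow> real) \<Rightarrow> nat \<Rightarrow> nat \<Rightarrow> real" where
  "red_S p N n = (\<Sum>j = 1..n - 1. red_p p N n n j)"

text \<open>\<open>red_mu p \<mu> N n i\<close> is \<open>\<mu>\<^sub>i\<^bsup>(n)\<^esup>\<close>.\<close>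

function red_mu :: "(nat \<Rightarrow> nat \<Rightarrow> real) \<Rightarrow> (nat \<Rightarrow> real) \<Rightarrow> nat \<Rightarrow> nat \<Rightarrow> nat \<Rightarrow> real" where
  "red_mu p \<mu> N n i =
     (if n < N
      then red_mu p \<mu> N (n + 1) i
           + red_p p N (n + 1) i (n + 1) * red_mu p \<mu> N (n + 1) (n + 1) / red_S p N (n + 1)
      else \<mu> i)"
  by pat_completeness auto
termination
  by (relation "Wellfounded.measure (\<lambda>(p, \<mu>, N, n, i). N - n)") auto

declare red_mu.simps [simp del]

text \<open>\<open>red_q p N t n i k\<close> is \<open>q\<^sub>i\<^sub>k\<^bsup>(t,n)\<^esup>\<close> and \<open>red_nu p \<mu> N t n i\<close> is \<open>\<nu>\<^sub>i\<^bsup>(t,n)\<^esup>\<close>.\<close>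

function red_q :: "(nat \<Rightarrow> nat \<Rightarrow> real) \<Rightarrow> nat \<Rightarrow> nat \<Rightarrow> nat \<Rightarrow> nat \<Rightarrow> nat \<Rightarrow> real" where
  "red_q p N t n i k =
     (if t < n - 1
      then red_q p N (t + 1) n i k
           + red_q p N (t + 1) n i (t + 1) * red_q p N (t + 1) n (t + 1) k
             / (1 - red_q p N (t + 1) n (t + 1) (t + 1))
      else red_p p N n i k)"
  by pat_completeness auto
termination
  by (relation "Wellfounded.measure (\<lambda>(p, N, t, n, i, k). n - 1 - t)") auto

declare red_q.simps [simp del]

function red_nu ::
  "(nat \<Rightarrow> nat \<Rightarrow> real) \<Rightarrow> (nat \<Rightarrow> real) \<Rightarrow> nat \<Rightarrow> nat \<Rightarrow> nat \<Rightarrow> nat \<Rightarrow> real" where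
  "red_nu p \<mu> N t n i =
     (if t < n - 1
      then red_nu p \<mu> N (t + 1) n i
           + red_q p N (t + 1) n i (t + 1) * red_nu p \<mu> N (t + 1) n (t + 1)
             / (1 - red_q p N (t + 1) n (t + 1) (t + 1))
      else red_mu p \<mu> N n i)"
  by pat_completeness auto
termination
  by (relation "Wellfounded.measure (\<lambda>(p, \<mu>, N, t, n, i). n - 1 - t)") auto

declare red_nu.simps [simp del]

definition red_R :: "(nat \<Rightarrow> nat \<Rightarrow> real) \<Rightarrow> nat \<Rightarrow> nat \<Rightarrow> nat \<Rightarrow> real" where
  "red_R p N i n = 1 - red_q p N i n i i"

end

theory Submission imports Defs begin

text \<open>
  Fix a target \<open>j\<close> and let \<open>V\<^sub>K(s)\<close> be the expected time spent in the first \<open>K\<close> steps from \<open>s\<close>,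
  stopped on entering \<open>j\<close>. The Markov renewal property, used on histories ending in \<open>s\<close>, gives
  \<open>V\<^bsub>K+1\<^esub>(s) = \<mu>\<^sub>s + (\<Sum>l\<noteq>j. p\<^sub>s\<^sub>l V\<^sub>K(l))\<close>; the expectation of a holding time depends only on the kernel
  row because the kernel determines its distribution function. A nonnegative solution of the limiting
  linear system, which exists by eliminating states one at a time, dominates all \<open>V\<^sub>K\<close>. Unit costs
  instead of holding times show that \<open>j\<close> is reached almost surely, hence \<open>m\<^sub>i\<^sub>j = sup V\<^sub>K(i)\<close> is finite and
  satisfies the first-step equations. Each reduction step of the algorithm is Gaussian elimination of
  one state from these equations; irreducibility keeps the pivots \<open>S(n)\<close> and \<open>R(i,n)\<close> positive.
\<close>

subsection \<open>Elimination of a state\<close>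

text \<open>The chain watched only while it is off \<open>s\<close>: the factor
  \<open>1 / (1 - P s s)\<close> sums the geometric series of repeated stays at \<open>s\<close>.
  The steps of \<open>red_q\<close> have this form, and those of \<open>red_p\<close> do once the
  rows are known to sum to 1.\<close>

definition censor :: "('s \<Rightarrow> 's \<Rightarrow> real) \<Rightarrow> 's \<Rightarrow> 's \<Rightarrow> 's \<Rightarrow> real" where
  "censor P s i k = P i k + P i s * P s k / (1 - P s s)"

text \<open>For a substochastic matrix, \<open>drains A x P\<close> says that no set of states avoiding \<open>x\<close> is closed
  and loses no mass. With \<open>x \<in> A\<close> for all such \<open>x\<close> this is irreducibility; with \<open>x \<notin> A\<close> it is
  transience of all of \<open>A\<close>. Both cases are preserved by eliminating a state.\<close>

definition drains :: "'s set \<Rightarrow> 's \<Rightarrow> ('s \<Rightarrow> 's \<Rightarrow> real) \<Rightarrow> bool" where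
  "drains A x P \<longleftrightarrow>
     (\<forall>i\<in>A. \<forall>k\<in>A. 0 \<le> P i k) \<and> (\<forall>i\<in>A. (\<Sum>k\<in>A. P i k) \<le> 1) \<and>
     (\<forall>B. B \<subseteq> A - {x} \<longrightarrow> B \<noteq> {} \<longrightarrow> (\<exists>i\<in>B. (\<Sum>k\<in>B. P i k) < 1))"

lemma drains_leak:
  assumes "drains A x P" "B \<subseteq> A - {x}" "B \<noteq> {}"
  shows "\<exists>i\<in>B. (\<Sum>k\<in>B. P i k) < 1"
  using assms unfolding drains_def by simp

text \<open>Every divisor in the elimination is a pivot \<open>1 - P s s\<close>; the singleton case
  of \<open>drains\<close> keeps it positive.\<close>

lemma drains_diag:
  assumes "drains A x P" "s \<in> A" "s \<noteq> x"
  shows "P s s < 1"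
proof -
  have "\<exists>i\<in>{s}. (\<Sum>k\<in>{s}. P i k) < 1"
    by (rule drains_leak[OF assms(1)]) (use assms in auto)
  then show ?thesis by simp
qed

text \<open>Passes from irreducibility to transience: the sets that must leak stay the same, but
  they now are all nonempty subsets of the index set.\<close>

lemma drains_Diff_target:
  assumes "finite A" and "drains A x P"
  shows "drains (A - {x}) x P"
proof -
  have "(\<Sum>k\<in>A - {x}. P i k) \<le> 1" if "i \<in> A" for i
  proof -
    have "(\<Sum>k\<in>A - {x}. P i k) \<le> (\<Sum>k\<in>A. P i k)"
      using that assms by (intro sum_mono2) (auto simp: drains_def)
    then show ?thesis using that assms(2) unfolding drains_def by fastforce
  qed
  then show ?thesis
    using assms(2) unfolding drains_def by auto
qed

lemma sum_censor:
  "(\<Sum>k\<in>B. censor P s i k) = (\<Sum>k\<in>B. P i k) + P i s * (\<Sum>k\<in>B. P s k) / (1 - P s s)"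
  by (simp add: censor_def sum.distrib sum_distrib_left sum_divide_distrib)

text \<open>Suppose \<open>B\<close> loses no mass after censoring. Then rows from \<open>B\<close>
  are full on \<open>insert s B\<close>, so the latter leaks only at \<open>s\<close>. Excursions
  through \<open>s\<close> would lose mass, hence \<open>B\<close> never enters \<open>s\<close> and
  had no leak under \<open>P\<close> either.\<close>

lemma drains_censor:
  assumes fin: "finite A" and dr: "drains A x P" and s: "s \<in> A" "s \<noteq> x"
  shows "drains (A - {s}) x (censor P s)"
proof -
  have nonneg: "\<And>i k. i \<in> A \<Longrightarrow> k \<in> A \<Longrightarrow> 0 \<le> P i k"
    and row: "\<And>i. i \<in> A \<Longrightarrow> (\<Sum>k\<in>A. P i k) \<le> 1"
    and leak: "\<And>B. B \<subseteq> A - {x} \<Longrightarrow> B \<noteq> {} \<Longrightarrow> \<exists>i\<in>B. (\<Sum>k\<in>B. P i k) < 1"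
    using dr unfolding drains_def by auto
  have ss: "0 < 1 - P s s" using drains_diag[OF dr s] by simp
  have ins: "(\<Sum>k\<in>insert s B. P i k) = P i s + (\<Sum>k\<in>B. P i k)" if "B \<subseteq> A - {s}" for B i
    using that fin by (subst sum.insert) (auto intro: finite_subset)
  have sub: "(\<Sum>k\<in>insert s B. P i k) \<le> 1" if "B \<subseteq> A - {s}" "i \<in> A" for B i
  proof -
    have "(\<Sum>k\<in>insert s B. P i k) \<le> (\<Sum>k\<in>A. P i k)"
      using that fin s nonneg by (intro sum_mono2) auto
    then show ?thesis using row[OF that(2)] by linarith
  qed
  \<comment> \<open>The quotient is the probability that the exit from \<open>s\<close> leads into
    \<open>B\<close>.\<close>
  have ratio: "(\<Sum>k\<in>B. P s k) / (1 - P s s) \<le> 1" if "B \<subseteq> A - {s}" for B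
    using sub[OF that s(1)] ins[OF that, of s] ss by simp
  have bound: "(\<Sum>k\<in>B. censor P s i k) \<le> (\<Sum>k\<in>insert s B. P i k)"
    if "B \<subseteq> A - {s}" "i \<in> A" for B i
    using mult_left_mono[OF ratio[OF that(1)] nonneg[OF that(2) s(1)]]
    by (simp add: sum_censor ins[OF that(1)])
  have "\<exists>i\<in>B. (\<Sum>k\<in>B. censor P s i k) < 1" if B: "B \<subseteq> A - {s} - {x}" "B \<noteq> {}" for B
  proof (rule ccontr)
    assume "\<not> ?thesis"
    then have no: "\<And>i. i \<in> B \<Longrightarrow> 1 \<le> (\<Sum>k\<in>B. censor P s i k)" by force
    have Bs: "B \<subseteq> A - {s}" using B by auto
    have one: "(\<Sum>k\<in>insert s B. P i k) = 1" if "i \<in> B" for i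
    proof -
      have "i \<in> A" using that Bs by auto
      then show ?thesis using no[OF that] bound[OF Bs, of i] sub[OF Bs, of i] by linarith
    qed
    obtain i where i: "i \<in> insert s B" "(\<Sum>k\<in>insert s B. P i k) < 1"
      using leak[of "insert s B"] B s by auto
    then have "(\<Sum>k\<in>insert s B. P s k) < 1" using one by fastforce
    then have strict: "(\<Sum>k\<in>B. P s k) / (1 - P s s) < 1"
      using ins[OF Bs, of s] ss by simp
    have zero: "P i s = 0" if "i \<in> B" for i
    proof (rule ccontr)
      assume "P i s \<noteq> 0"
      moreover have "i \<in> A" using that Bs by auto
      ultimately have "0 < P i s" using nonneg[of i s] s by simp
      then have "P i s * ((\<Sum>k\<in>B. P s k) / (1 - P s s)) < P i s * 1"
        by (rule mult_strict_left_mono[OF strict])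
      then show False
        using no[OF that] one[OF that] by (simp add: sum_censor ins[OF Bs])
    qed
    \<comment> \<open>With no mass entering \<open>s\<close>, the row sums over \<open>B\<close> and
      over \<open>insert s B\<close> agree, against the leak of \<open>B\<close> itself.\<close>
    obtain i where i: "i \<in> B" "(\<Sum>k\<in>B. P i k) < 1"
      using leak[of B] B by auto
    then show False using one[OF i(1)] zero[OF i(1)] ins[OF Bs, of i] by simp
  qed
  moreover have "\<forall>i\<in>A - {s}. \<forall>k\<in>A - {s}. 0 \<le> censor P s i k"
    unfolding censor_def using nonneg s ss by (intro ballI add_nonneg_nonneg divide_nonneg_pos mult_nonneg_nonneg) auto
  moreover have "\<forall>i\<in>A - {s}. (\<Sum>k\<in>A - {s}. censor P s i k) \<le> 1"
  proof
    fix i assume "i \<in> A - {s}"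
    then show "(\<Sum>k\<in>A - {s}. censor P s i k) \<le> 1"
      using bound[of "A - {s}" i] sub[of "A - {s}" i] by force
  qed
  ultimately show ?thesis unfolding drains_def by blast
qed

text \<open>Solve the equation at \<open>s\<close> for \<open>h s\<close> and substitute. The target
  \<open>x\<close> may lie in \<open>A\<close> or outside it, so that the same step serves
  \<open>red_p\<close> and \<open>red_q\<close>.\<close>

lemma first_step_censor:
  fixes h c :: "'s \<Rightarrow> real"
  assumes fin: "finite A" and s: "s \<in> A" "s \<noteq> x" "P s s \<noteq> 1"
    and h: "\<And>i. i \<in> A \<Longrightarrow> h i = c i + (\<Sum>k\<in>A - {x}. P i k * h k)"
    and i: "i \<in> A"
  shows "h i = (c i + P i s * c s / (1 - P s s)) + (\<Sum>k\<in>A - {s} - {x}. censor P s i k * h k)"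
proof -
  let ?B = "A - {s} - {x}"
  have eq: "A - {x} = insert s ?B" using s by auto
  have split: "h i = c i + P i s * h s + (\<Sum>k\<in>?B. P i k * h k)" if "i \<in> A" for i
    unfolding h[OF that] eq using fin by (subst sum.insert) auto
  have hs: "h s = (c s + (\<Sum>k\<in>?B. P s k * h k)) / (1 - P s s)"
    using split[OF s(1)] s(3) by (simp add: field_simps)
  have "(\<Sum>k\<in>?B. censor P s i k * h k)
      = (\<Sum>k\<in>?B. P i k * h k) + P i s * (\<Sum>k\<in>?B. P s k * h k) / (1 - P s s)"
    by (simp add: censor_def distrib_right sum.distrib sum_distrib_left sum_divide_distrib mult.assoc)
  then show ?thesis
    using split[OF i] hs by (simp add: add_divide_distrib distrib_left)
qed

text \<open>Forward elimination and back-substitution: the induction hypothesis solves the censored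
  system with cost \<open>c'\<close>, and positive pivots preserve nonnegativity.\<close>

lemma drains_solution:
  fixes c :: "'s \<Rightarrow> real"
  assumes "finite A" "drains A x P" "x \<notin> A" "\<And>i. i \<in> A \<Longrightarrow> 0 \<le> c i"
  shows "\<exists>h. \<forall>i\<in>A. 0 \<le> h i \<and> h i = c i + (\<Sum>k\<in>A. P i k * h k)"
  using assms
proof (induction A arbitrary: P c rule: finite_induct)
  case (insert s A)
  let ?A = "insert s A"
  define d where "d = 1 - P s s"
  define c' where "c' i = c i + P i s * c s / d" for i
  have d: "0 < d" unfolding d_def using drains_diag[OF insert.prems(1), of s] insert.prems by auto
  have nonneg: "0 \<le> P i k" if "i \<in> ?A" "k \<in> ?A" for i k
    using insert.prems(1) that unfolding drains_def by blast
  have "drains A x (censor P s)"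
    using drains_censor[OF _ insert.prems(1), of s] insert by auto
  moreover have "0 \<le> c' i" if "i \<in> A" for i
    unfolding c'_def using that nonneg insert.prems(3) d by (intro add_nonneg_nonneg divide_nonneg_pos mult_nonneg_nonneg) auto
  ultimately obtain h where
      "\<forall>i\<in>A. 0 \<le> h i \<and> h i = c' i + (\<Sum>k\<in>A. censor P s i k * h k)"
    using insert.IH[of "censor P s" c'] insert.prems(2) by blast
  then have h: "\<And>i. i \<in> A \<Longrightarrow> 0 \<le> h i"
      "\<And>i. i \<in> A \<Longrightarrow> h i = c' i + (\<Sum>k\<in>A. censor P s i k * h k)"
    by blast+
  \<comment> \<open>The value at \<open>s\<close> is the one forced by the equation at
    \<open>s\<close>.\<close>
  define g where "g = h(s := (c s + (\<Sum>k\<in>A. P s k * h k)) / d)"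
  have gA: "g k = h k" if "k \<in> A" for k using that insert.hyps by (auto simp: g_def)
  have gs: "g s = (c s + (\<Sum>k\<in>A. P s k * h k)) / d" by (simp add: g_def)
  have sumg: "(\<Sum>k\<in>?A. P i k * g k) = P i s * g s + (\<Sum>k\<in>A. P i k * h k)" for i
    using insert.hyps gA by simp
  have "0 \<le> g s"
    unfolding gs using d insert.prems(3) nonneg h(1)
    by (intro divide_nonneg_pos add_nonneg_nonneg sum_nonneg mult_nonneg_nonneg) auto
  moreover have "g s = c s + (\<Sum>k\<in>?A. P s k * g k)"
    unfolding sumg using gs d by (simp add: d_def field_simps)
  moreover have "g i = c i + (\<Sum>k\<in>?A. P i k * g k)" if "i \<in> A" for i
  proof -
    have "(\<Sum>k\<in>A. censor P s i k * h k)
        = (\<Sum>k\<in>A. P i k * h k) + P i s * (\<Sum>k\<in>A. P s k * h k) / d"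
      by (simp add: censor_def d_def distrib_right sum.distrib sum_distrib_left sum_divide_distrib mult.assoc)
    then show ?thesis
      unfolding sumg gs using h(2)[OF that] gA[OF that]
      by (simp add: c'_def add_divide_distrib distrib_left)
  qed
  ultimately have "\<forall>i\<in>?A. 0 \<le> g i \<and> g i = c i + (\<Sum>k\<in>?A. P i k * g k)"
    using h(1) gA by (metis insert_iff)
  then show ?case by blast
qed auto

section \<open>Reduced matrices and first-step equations\<close>

text \<open>Since full rows sum to 1, a set that loses no mass has no positive transition out of it,
  and no path from it could reach \<open>x\<close>.\<close>

lemma drains_irreducible:
  assumes irr: "irreducible_matrix N p" and x: "x \<in> {1..N}"
    and nonneg: "\<And>i k. i \<in> {1..N} \<Longrightarrow> k \<in> {1..N} \<Longrightarrow> 0 \<le> p i k"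
    and row: "\<And>i. i \<in> {1..N} \<Longrightarrow> (\<Sum>k = 1..N. p i k) = 1"
  shows "drains {1..N} x p"
proof -
  have "\<exists>i\<in>B. (\<Sum>k\<in>B. p i k) < 1" if B: "B \<subseteq> {1..N} - {x}" "B \<noteq> {}" for B
  proof (rule ccontr)
    assume "\<not> ?thesis"
    then have no: "\<And>i. i \<in> B \<Longrightarrow> 1 \<le> (\<Sum>k\<in>B. p i k)" by force
    have closed: "k \<in> B" if "i \<in> B" "k \<in> {1..N}" "p i k > 0" for i k
    proof (rule ccontr)
      assume "k \<notin> B"
      then have "p i k + (\<Sum>k\<in>B. p i k) = (\<Sum>k\<in>insert k B. p i k)"
        using B by (subst sum.insert) (auto intro: finite_subset)
      also have "\<dots> \<le> (\<Sum>k = 1..N. p i k)"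
        using B that nonneg by (intro sum_mono2) auto
      also have "\<dots> = 1" using row B that by auto
      finally show False using no[OF that(1)] that(3) by simp
    qed
    obtain b where b: "b \<in> B" using B by auto
    have "(b, x) \<in> {(a, b). a \<in> {1..N} \<and> b \<in> {1..N} \<and> p a b > 0}\<^sup>*"
      using irr b x B unfolding irreducible_matrix_def by auto
    then have "x \<in> B"
      by (induction rule: rtrancl_induct) (use b closed in auto)
    then show False using B by auto
  qed
  then show ?thesis unfolding drains_def using nonneg row by auto
qed

text \<open>The two facts go down the recursion together: row sums turn the divisor of
  \<open>red_p\<close> into the pivot of \<open>censor\<close>, and draining makes that pivot
  positive.\<close>

lemma
  assumes "irreducible_matrix N p"
    and "\<And>i k. i \<in> {1..N} \<Longrightarrow> k \<in> {1..N} \<Longrightarrow> 0 \<le> p i k"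
    and "\<And>i. i \<in> {1..N} \<Longrightarrow> (\<Sum>k = 1..N. p i k) = 1"
    and "n \<le> N" "1 \<le> n"
  shows red_p_drains: "\<And>x. x \<in> {1..n} \<Longrightarrow> drains {1..n} x (red_p p N n)"
    and red_p_row: "\<And>i. i \<in> {1..n} \<Longrightarrow> (\<Sum>k = 1..n. red_p p N n i k) = 1"
proof -
  have "(\<forall>x\<in>{1..n}. drains {1..n} x (red_p p N n)) \<and> (\<forall>i\<in>{1..n}. (\<Sum>k = 1..n. red_p p N n i k) = 1)"
    using assms(4,5)
  proof (induction n rule: inc_induct)
    case base
    have "red_p p N N = p" by (intro ext) (simp add: red_p.simps)
    then show ?case using drains_irreducible[OF assms(1)] assms(2,3) by simp
  next
    case (step n)
    let ?P = "red_p p N (Suc n)"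
    have dr: "drains {1..Suc n} x ?P" if "x \<in> {1..n}" for x using step that by auto
    have row: "(\<Sum>k = 1..Suc n. ?P i k) = 1" if "i \<in> {1..Suc n}" for i using step that by auto
    have S: "(\<Sum>k = 1..n. ?P (Suc n) k) = 1 - ?P (Suc n) (Suc n)"
      using row[of "Suc n"] by simp
    have eq: "red_p p N n = censor ?P (Suc n)"
      using step S by (intro ext) (simp add: red_p.simps[of p N n] censor_def)
    \<comment> \<open>Any target other than \<open>Suc n\<close> would do; 1 is one because
      \<open>n\<close> is at least 1.\<close>
    have pos: "?P (Suc n) (Suc n) < 1"
      using drains_diag[OF dr[of 1], of "Suc n"] step by simp
    have A: "{1..Suc n} - {Suc n} = {1..n}" by auto
    have "drains {1..n} x (red_p p N n)" if "x \<in> {1..n}" for x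
      using drains_censor[OF _ dr[OF that], of "Suc n"] that unfolding A eq by simp
    moreover have "(\<Sum>k = 1..n. red_p p N n i k) = 1" if "i \<in> {1..n}" for i
      using row[of i] that pos unfolding eq sum_censor S by simp
    ultimately show ?case by blast
  qed
  then show "\<And>x. x \<in> {1..n} \<Longrightarrow> drains {1..n} x (red_p p N n)"
    and "\<And>i. i \<in> {1..n} \<Longrightarrow> (\<Sum>k = 1..n. red_p p N n i k) = 1" by auto
qed

lemma red_S_eq:
  assumes "irreducible_matrix N p"
    and "\<And>i k. i \<in> {1..N} \<Longrightarrow> k \<in> {1..N} \<Longrightarrow> 0 \<le> p i k"
    and "\<And>i. i \<in> {1..N} \<Longrightarrow> (\<Sum>k = 1..N. p i k) = 1"
    and "n \<le> N" "2 \<le> n"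
  shows "red_S p N n = 1 - red_p p N n n n" and "red_p p N n n n < 1"
proof -
  have n: "{1..n} = insert n {1..n - 1}" using assms(5) by auto
  have "red_p p N n n n + red_S p N n = (\<Sum>k = 1..n. red_p p N n n k)"
    unfolding n red_S_def using assms(5) by (subst sum.insert) auto
  then show "red_S p N n = 1 - red_p p N n n n"
    using red_p_row[OF assms(1-4), of n] assms(5) by simp
  show "red_p p N n n n < 1"
    using drains_diag[OF red_p_drains[OF assms(1-4), of 1], of n] assms(5) by auto
qed

lemma red_p_eq_censor:
  assumes "irreducible_matrix N p"
    and "\<And>i k. i \<in> {1..N} \<Longrightarrow> k \<in> {1..N} \<Longrightarrow> 0 \<le> p i k"
    and "\<And>i. i \<in> {1..N} \<Longrightarrow> (\<Sum>k = 1..N. p i k) = 1"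
    and "n < N" "1 \<le> n"
  shows "red_p p N n = censor (red_p p N (Suc n)) (Suc n)"
  using red_S_eq(1)[OF assms(1-3), of "Suc n"] assms(4,5)
  by (intro ext) (simp add: red_p.simps[of p N n] censor_def red_S_def)

text \<open>Every eliminated state exceeds \<open>n\<close> while \<open>j\<close> does not, so the
  target is never removed and \<open>first_step_censor\<close> applies at each level.\<close>

lemma red_p_first_step:
  assumes p: "irreducible_matrix N p"
    "\<And>i k. i \<in> {1..N} \<Longrightarrow> k \<in> {1..N} \<Longrightarrow> 0 \<le> p i k"
    "\<And>i. i \<in> {1..N} \<Longrightarrow> (\<Sum>k = 1..N. p i k) = 1"
    and h: "\<And>i. i \<in> {1..N} \<Longrightarrow> h i = \<mu> i + (\<Sum>k\<in>{1..N} - {j}. p i k * h k)"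
    and n: "n \<le> N" "j \<in> {1..n}" and i: "i \<in> {1..n}"
  shows "h i = red_mu p \<mu> N n i + (\<Sum>k\<in>{1..n} - {j}. red_p p N n i k * h k)"
  using n i
proof (induction n arbitrary: i rule: inc_induct)
  case base
  then show ?case using h[of i] by (simp add: red_mu.simps red_p.simps)
next
  case (step n)
  let ?P = "red_p p N (Suc n)"
  have A: "{1..Suc n} - {Suc n} = {1..n}" by auto
  have S: "red_S p N (Suc n) = 1 - ?P (Suc n) (Suc n)" "?P (Suc n) (Suc n) < 1"
    using red_S_eq[OF p, of "Suc n"] step by auto
  have mu: "red_mu p \<mu> N n i
      = red_mu p \<mu> N (Suc n) i + ?P i (Suc n) * red_mu p \<mu> N (Suc n) (Suc n) / (1 - ?P (Suc n) (Suc n))"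
    using step S by (simp add: red_mu.simps[of p \<mu> N n])
  have eq: "red_p p N n = censor ?P (Suc n)"
    using red_p_eq_censor[OF p, of n] step by auto
  show ?case
    unfolding mu eq A[symmetric]
    by (rule first_step_censor) (use step S in auto)
qed

text \<open>The recursion starts with the target \<open>n\<close> already deleted, so draining here
  means transience of \<open>{1..t}\<close>.\<close>

lemma red_q_drains:
  assumes "drains {1..n} n (red_p p N n)" and "t \<le> n - 1"
  shows "drains {1..t} n (red_q p N t n)"
  using assms(2)
proof (induction t rule: inc_induct)
  case base
  have "red_q p N (n - 1) n = red_p p N n" by (intro ext) (simp add: red_q.simps)
  moreover have "{1..n} - {n} = {1..n - 1}" by auto
  ultimately show ?case using drains_Diff_target[OF _ assms(1)] by simp
next
  case (step t)
  have eq: "red_q p N t n = censor (red_q p N (Suc t) n) (Suc t)"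
    using step by (intro ext) (simp add: red_q.simps[of p N t] censor_def)
  have "{1..Suc t} - {Suc t} = {1..t}" by auto
  then show ?case unfolding eq using drains_censor[OF _ step.IH, of "Suc t"] step.hyps by simp
qed

text \<open>Going below level \<open>n\<close> with \<open>red_p\<close> would eliminate the target
  \<open>n\<close> itself. Skipping it and eliminating \<open>n - 1\<close>, \<open>n - 2\<close>
  and so on leaves only unknowns of index at most \<open>t\<close>.\<close>

lemma red_q_first_step:
  assumes dr: "drains {1..n} n (red_p p N n)"
    and h: "\<And>i. i \<in> {1..n} \<Longrightarrow> h i = red_mu p \<mu> N n i + (\<Sum>k\<in>{1..n} - {n}. red_p p N n i k * h k)"
    and "t \<le> n - 1" "i \<in> {1..t}"
  shows "h i = red_nu p \<mu> N t n i + (\<Sum>k = 1..t. red_q p N t n i k * h k)"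
  using assms(3,4)
proof (induction t arbitrary: i rule: inc_induct)
  case base
  have "{1..n} - {n} = {1..n - 1}" by auto
  moreover have "red_q p N (n - 1) n = red_p p N n" by (intro ext) (simp add: red_q.simps)
  moreover have "red_nu p \<mu> N (n - 1) n i = red_mu p \<mu> N n i" by (simp add: red_nu.simps)
  moreover have "i \<in> {1..n}" using base by auto
  ultimately show ?case using h by metis
next
  case (step t)
  let ?P = "red_q p N (Suc t) n"
  have A: "{1..Suc t} - {Suc t} - {n} = {1..t}" "{1..Suc t} - {n} = {1..Suc t}"
    using step by auto
  have pos: "?P (Suc t) (Suc t) < 1"
    using drains_diag[OF red_q_drains[OF dr, of "Suc t"], of "Suc t"] step by auto
  have nu: "red_nu p \<mu> N t n i
      = red_nu p \<mu> N (Suc t) n i + ?P i (Suc t) * red_nu p \<mu> N (Suc t) n (Suc t) / (1 - ?P (Suc t) (Suc t))"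
    using step by (simp add: red_nu.simps[of p \<mu> N t])
  have eq: "red_q p N t n = censor ?P (Suc t)"
    using step by (intro ext) (simp add: red_q.simps[of p N t] censor_def)
  show ?case
    unfolding nu eq A(1)[symmetric]
  proof (rule first_step_censor)
    show "h k = red_nu p \<mu> N (Suc t) n k + (\<Sum>l\<in>{1..Suc t} - {n}. ?P k l * h l)"
      if "k \<in> {1..Suc t}" for k
      unfolding A(2) by (rule step.IH[OF that])
  qed (use step.hyps step.prems pos in auto)
qed

subsection \<open>The kernel of a Markov renewal process\<close>

locale markov_renewal =
  fixes M :: "'a measure" and N :: nat and Q :: "nat \<Rightarrow> nat \<Rightarrow> real \<Rightarrow> real"
    and X :: "nat \<Rightarrow> 'a \<Rightarrow> nat" and T :: "nat \<Rightarrow> 'a \<Rightarrow> real"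
  assumes mrp: "markov_renewal_process M N Q X T"
begin

sublocale prob_space M
  using mrp by (simp add: markov_renewal_process_def)

abbreviation H :: "nat \<Rightarrow> 'a measure" where "H \<equiv> mrp_history M N X T"

lemma measurable_X [measurable]: "X k \<in> measurable M (count_space {1..N})"
  and measurable_T [measurable]: "T k \<in> borel_measurable M"
  using mrp by (simp_all add: markov_renewal_process_def)

lemma X_in_states: "\<omega> \<in> space M \<Longrightarrow> X k \<omega> \<in> {1..N}"
  using measurable_space[OF measurable_X[of k], of \<omega>] by simp

lemma space_history [simp]: "space (H k) = space M"
  by (simp add: mrp_history_def)

lemma measurable_history:
  assumes "l \<le> k"
  shows "X l \<in> measurable (H k) (count_space {1..N})" and "T l \<in> borel_measurable (H k)"
proof -
  have "(\<lambda>\<omega>. \<lambda>l\<in>{..k}. (X l \<omega>, T l \<omega>)) \<in> measurable (H k) (\<Pi>\<^sub>M l\<in>{..k}. count_space {1..N} \<Otimes>\<^sub>M borel)"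
    unfolding mrp_history_def
    by (rule measurable_vimage_algebra1) (use X_in_states in \<open>auto simp: space_PiM space_pair_measure\<close>)
  then have "(\<lambda>\<omega>. (\<lambda>l\<in>{..k}. (X l \<omega>, T l \<omega>)) l) \<in> measurable (H k) (count_space {1..N} \<Otimes>\<^sub>M borel)"
    by (rule measurable_compose[OF _ measurable_component_singleton]) (use assms in auto)
  then have *: "(\<lambda>\<omega>. (X l \<omega>, T l \<omega>)) \<in> measurable (H k) (count_space {1..N} \<Otimes>\<^sub>M borel)"
    using assms by simp
  show "X l \<in> measurable (H k) (count_space {1..N})" "T l \<in> borel_measurable (H k)"
    using measurable_compose[OF * measurable_fst] measurable_compose[OF * measurable_snd] by auto
qed

lemma history_subset:
  assumes "space K = space M"
    and "\<And>l. l \<le> k \<Longrightarrow> X l \<in> measurable K (count_space {1..N})"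
    and "\<And>l. l \<le> k \<Longrightarrow> T l \<in> borel_measurable K"
  shows "sets (H k) \<subseteq> sets K"
  unfolding mrp_history_def
  by (rule sets_image_in_sets[OF assms(1)], rule measurable_restrict) (use assms in auto)

lemma history_sets_M: "E \<in> sets (H k) \<Longrightarrow> E \<in> sets M"
  using history_subset[OF refl measurable_X measurable_T] by blast

lemma history_mono: "E \<in> sets (H k) \<Longrightarrow> E \<in> sets (H (Suc k))"
  using history_subset[of "H (Suc k)" k] measurable_history[of _ "Suc k"]
  by (meson le_SucI space_history subsetD)

lemma state_in_history: "{\<omega> \<in> space M. X k \<omega> = s} \<in> sets (H k)"
proof -
  have "{\<omega> \<in> space M. X k \<omega> = s} = X k -` ({s} \<inter> {1..N}) \<inter> space (H k)"
    using X_in_states by auto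
  also have "\<dots> \<in> sets (H k)"
    by (rule measurable_sets[OF measurable_history(1)]) auto
  finally show ?thesis .
qed

lemma measurable_state [measurable]: "Measurable.pred M (\<lambda>\<omega>. X k \<omega> = s)"
  unfolding pred_def by (rule history_sets_M[OF state_in_history])

lemma history_step:
  assumes "E \<in> sets (H k)"
  shows "E \<inter> {\<omega> \<in> space M. X (Suc k) \<omega> = l} \<in> sets (H (Suc k))"
  using history_mono[OF assms] state_in_history by blast

text \<open>The Markov renewal clause integrated over a history event. The current state is
  \<open>s\<close> throughout \<open>E\<close>, so the kernel value is a constant there.\<close>

lemma kernel:
  assumes E: "E \<in> sets (H k)" "E \<subseteq> {\<omega> \<in> space M. X k \<omega> = s}" and l: "l \<in> {1..N}"
  shows "measure M (E \<inter> {\<omega> \<in> space M. X (Suc k) \<omega> = l \<and> T (Suc k) \<omega> - T k \<omega> \<le> t})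
    = Q s l t * measure M E"
proof -
  interpret finite_measure_subalgebra M "H k"
    by unfold_locales (use history_sets_M in \<open>auto simp: subalgebra_def\<close>)
  let ?D = "{\<omega> \<in> space M. X (Suc k) \<omega> = l \<and> T (Suc k) \<omega> - T k \<omega> \<le> t}"
  have [measurable]: "E \<in> sets M" by (rule history_sets_M[OF E(1)])
  have D [measurable]: "?D \<in> sets M" by measurable
  have "measure M (E \<inter> ?D) = (\<integral>\<omega>\<in>E. indicator ?D \<omega> \<partial>M)"
    unfolding set_lebesgue_integral_def
    by (simp add: indicator_inter_arith[symmetric] Int_assoc)
  also have "\<dots> = (\<integral>\<omega>\<in>E. real_cond_exp M (H k) (indicator ?D) \<omega> \<partial>M)"
    by (rule real_cond_exp_intA) (auto simp: E(1) less_top[symmetric])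
  also have "\<dots> = (\<integral>\<omega>\<in>E. Q s l t \<partial>M)"
  proof (rule set_lebesgue_integral_cong_AE)
    have "AE \<omega> in M. real_cond_exp M (H k) (indicator ?D) \<omega> = Q (X k \<omega>) l t"
      using mrp l unfolding markov_renewal_process_def by blast
    then show "AE \<omega>\<in>E in M. real_cond_exp M (H k) (indicator ?D) \<omega> = Q s l t"
      by eventually_elim (use E(2) in auto)
  qed auto
  also have "\<dots> = Q s l t * measure M E"
    unfolding set_lebesgue_integral_def by simp
  finally show ?thesis .
qed

text \<open>\<open>embedded_transition\<close> is a \<open>Lim\<close>, so convergence has to be
  shown. Positive mass of \<open>E\<close> makes \<open>Q s l\<close> a quotient of measures, and
  the events in the numerator increase to the whole transition event.\<close>

lemma kernel_limit:
  assumes E: "E \<in> sets (H k)" "E \<subseteq> {\<omega> \<in> space M. X k \<omega> = s}" and l: "l \<in> {1..N}"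
    and pos: "measure M E > 0"
  shows "(Q s l \<longlongrightarrow> measure M (E \<inter> {\<omega> \<in> space M. X (Suc k) \<omega> = l}) / measure M E) at_top"
\<comment> \<open>Monotonicity of \<open>Q s l\<close> reduces the limit to integer arguments, where
  continuity from below applies.\<close>
proof (rule tendsto_at_topI_sequentially_real)
  let ?D = "\<lambda>t. E \<inter> {\<omega> \<in> space M. X (Suc k) \<omega> = l \<and> T (Suc k) \<omega> - T k \<omega> \<le> t}"
  have [measurable]: "E \<in> sets M" by (rule history_sets_M[OF E(1)])
  have D: "?D t \<in> sets M" for t by measurable
  have Q: "Q s l = (\<lambda>t. measure M (?D t) / measure M E)"
    using kernel[OF E l] pos by (auto simp: fun_eq_iff)
  have "measure M (?D t) \<le> measure M (?D u)" if "t \<le> u" for t u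
    using that D by (intro finite_measure_mono) auto
  then show "mono (Q s l)"
    using pos unfolding Q by (auto intro!: monoI divide_right_mono)
  have "(\<lambda>n. measure M (?D (real n))) \<longlonglongrightarrow> measure M (\<Union>n. ?D (real n))"
    using D by (intro finite_Lim_measure_incseq) (auto simp: incseq_def)
  also have "(\<Union>n. ?D (real n)) = E \<inter> {\<omega> \<in> space M. X (Suc k) \<omega> = l}"
    using real_arch_simple by auto
  finally show "(\<lambda>n. Q s l (real n)) \<longlonglongrightarrow> measure M (E \<inter> {\<omega> \<in> space M. X (Suc k) \<omega> = l}) / measure M E"
    unfolding Q using pos by (intro tendsto_intros) auto
qed

lemma measure_transition:
  assumes E: "E \<in> sets (H k)" "E \<subseteq> {\<omega> \<in> space M. X k \<omega> = s}" and l: "l \<in> {1..N}"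
  shows "measure M (E \<inter> {\<omega> \<in> space M. X (Suc k) \<omega> = l}) = embedded_transition Q s l * measure M E"
proof (cases "measure M E = 0")
  case True
  have "measure M (E \<inter> {\<omega> \<in> space M. X (Suc k) \<omega> = l}) \<le> measure M E"
    using history_sets_M[OF E(1)] by (intro finite_measure_mono) auto
  then show ?thesis using True by (simp add: measure_le_0_iff)
next
  case False
  then have pos: "measure M E > 0" by (simp add: zero_less_measure_iff)
  have "embedded_transition Q s l = measure M (E \<inter> {\<omega> \<in> space M. X (Suc k) \<omega> = l}) / measure M E"
    unfolding embedded_transition_def by (rule tendsto_Lim[OF _ kernel_limit[OF E l pos]]) simp
  then show ?thesis using False by simp
qed

lemma sum_measure_states:
  assumes "E \<in> sets M"
    and "\<And>l. l \<in> {1..N} \<Longrightarrow> F l = E \<inter> {\<omega> \<in> space M. X (Suc k) \<omega> = l \<and> P \<omega>}"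
    and [measurable]: "Measurable.pred M P"
  shows "(\<Sum>l = 1..N. measure M (F l)) = measure M (E \<inter> {\<omega> \<in> space M. P \<omega>})"
proof -
  have [measurable]: "E \<in> sets M" by fact
  have "(\<Sum>l = 1..N. measure M (F l)) = measure M (\<Union>l\<in>{1..N}. F l)"
    by (rule finite_measure_finite_Union[symmetric])
      (auto simp: disjoint_family_on_def assms(2))
  also have "(\<Union>l\<in>{1..N}. F l) = E \<inter> {\<omega> \<in> space M. P \<omega>}"
    using X_in_states[of _ "Suc k"] by (auto simp: assms(2))
  finally show ?thesis .
qed

text \<open>The row of \<open>Q\<close> at a state that is never visited is unconstrained; positive
  mass at time 0 lets it be read off the process.\<close>

lemma embedded_transition_nonneg:
  assumes "measure M {\<omega> \<in> space M. X 0 \<omega> = i} > 0" "k \<in> {1..N}"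
  shows "0 \<le> embedded_transition Q i k"
proof -
  have "0 \<le> embedded_transition Q i k * measure M {\<omega> \<in> space M. X 0 \<omega> = i}"
    by (subst measure_transition[OF state_in_history order_refl assms(2), symmetric]) simp
  then show ?thesis using assms(1) by (simp add: zero_le_mult_iff)
qed

lemma embedded_transition_row:
  assumes "measure M {\<omega> \<in> space M. X 0 \<omega> = i} > 0"
  shows "(\<Sum>k = 1..N. embedded_transition Q i k) = 1"
proof -
  let ?E = "{\<omega> \<in> space M. X 0 \<omega> = i}"
  have "(\<Sum>k = 1..N. embedded_transition Q i k) * measure M ?E
      = (\<Sum>k = 1..N. measure M (?E \<inter> {\<omega> \<in> space M. X (Suc 0) \<omega> = k}))"
    unfolding sum_distrib_right
    by (rule sum.cong) (auto simp only: measure_transition[OF state_in_history[of 0 i] order_refl])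
  also have "\<dots> = measure M (?E \<inter> {\<omega> \<in> space M. True})"
    by (rule sum_measure_states[of _ _ 0]) auto
  also have "?E \<inter> {\<omega> \<in> space M. True} = ?E" by auto
  finally show ?thesis using assms by simp
qed

section \<open>Laws of holding times\<close>

text \<open>Summing over the next state leaves a function of \<open>s\<close> and \<open>t\<close>
  alone, free of \<open>M\<close>, \<open>E\<close> and \<open>k\<close>; this makes holding times
  comparable across measures and times.\<close>

lemma cdf_holding_time:
  assumes E: "E \<in> sets (H k)" "E \<subseteq> {\<omega> \<in> space M. X k \<omega> = s}" and pos: "measure M E > 0"
  shows "cdf (distr (uniform_measure M E) borel (\<lambda>\<omega>. T (Suc k) \<omega> - T k \<omega>)) t = (\<Sum>l = 1..N. Q s l t)"
proof -
  let ?D = "\<lambda>l. {\<omega> \<in> space M. X (Suc k) \<omega> = l \<and> T (Suc k) \<omega> - T k \<omega> \<le> t}"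
  have [measurable]: "E \<in> sets M" by (rule history_sets_M[OF E(1)])
  have E0: "emeasure M E \<noteq> 0" "emeasure M E \<noteq> \<infinity>"
    using pos by (auto simp: emeasure_eq_measure)
  let ?F = "{\<omega> \<in> space M. T (Suc k) \<omega> - T k \<omega> \<le> t}"
  have "cdf (distr (uniform_measure M E) borel (\<lambda>\<omega>. T (Suc k) \<omega> - T k \<omega>)) t
      = measure (uniform_measure M E) ?F"
    unfolding cdf_def2 by (subst measure_distr) (auto intro!: arg_cong[where f = "measure _"])
  also have "\<dots> = measure M (E \<inter> ?F) / measure M E"
    by (rule measure_uniform_measure[OF E0]) measurable
  also have "measure M (E \<inter> ?F) = (\<Sum>l = 1..N. measure M (E \<inter> ?D l))"
    by (rule sum_measure_states[symmetric, of _ _ k]) auto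
  also have "\<dots> = (\<Sum>l = 1..N. Q s l t) * measure M E"
    unfolding sum_distrib_right by (rule sum.cong) (auto simp only: kernel[OF E])
  finally show ?thesis using pos by simp
qed

end

text \<open>Equal distribution functions give equal laws, hence equal means. Two measures occur
  because each starting state has its own, and the mean at \<open>s\<close> is taken under the one
  belonging to \<open>s\<close>.\<close>

lemma mean_holding_time_unique:
  assumes M: "markov_renewal M N Q X T" and M': "markov_renewal M' N Q X T"
    and E: "E \<in> sets (mrp_history M N X T k)" "E \<subseteq> {\<omega> \<in> space M. X k \<omega> = s}"
    and pos: "measure M' {\<omega> \<in> space M'. X k' \<omega> = s} > 0"
  shows "(\<integral>\<^sup>+\<omega>\<in>E. ennreal (T (Suc k) \<omega> - T k \<omega>) \<partial>M) = mean_holding_time M' X T k' s * emeasure M E"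
proof -
  interpret M: markov_renewal M N Q X T by fact
  interpret M': markov_renewal M' N Q X T by fact
  have [measurable]: "E \<in> sets M" by (rule M.history_sets_M[OF E(1)])
  show ?thesis
  proof (cases "measure M E = 0")
    \<comment> \<open>Conditioning on a null event is meaningless, but both sides vanish, even for
      an infinite mean, as \<open>\<infinity> * 0 = 0\<close>.\<close>
    case True
    then have "emeasure M E = 0" by (simp add: M.emeasure_eq_measure)
    then have "E \<in> null_sets M" by auto
    then have "AE \<omega> in M. \<omega> \<notin> E" by (rule AE_not_in)
    then have "(\<integral>\<^sup>+\<omega>\<in>E. ennreal (T (Suc k) \<omega> - T k \<omega>) \<partial>M) = (\<integral>\<^sup>+\<omega>. 0 \<partial>M)"
      by (intro nn_integral_cong_AE) (auto elim!: eventually_mono)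
    then show ?thesis using \<open>emeasure M E = 0\<close> by simp
  next
    case False
    let ?E' = "{\<omega> \<in> space M'. X k' \<omega> = s}"
    let ?U = "uniform_measure M E" and ?U' = "uniform_measure M' ?E'"
    let ?D = "\<lambda>k \<omega>. T (Suc k) \<omega> - T k \<omega>"
    have posE: "measure M E > 0" using False by (simp add: zero_less_measure_iff)
    have E0: "emeasure M E \<noteq> 0" "emeasure M E \<noteq> \<infinity>"
      using posE by (auto simp: M.emeasure_eq_measure)
    have E0': "emeasure M' ?E' \<noteq> 0" "emeasure M' ?E' \<noteq> \<infinity>"
      using pos by (auto simp: M'.emeasure_eq_measure)
    interpret U: prob_space ?U by (rule prob_space_uniform_measure[OF E0])
    interpret U': prob_space ?U' by (rule prob_space_uniform_measure[OF E0'])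
    have D [measurable]: "?D k \<in> borel_measurable ?U" "?D k' \<in> borel_measurable ?U'"
      by measurable
    have eq: "distr ?U borel (?D k) = distr ?U' borel (?D k')"
    proof (rule cdf_unique)
      show "real_distribution (distr ?U borel (?D k))" "real_distribution (distr ?U' borel (?D k'))"
        using U.real_distribution_distr U'.real_distribution_distr D by auto
      show "cdf (distr ?U borel (?D k)) = cdf (distr ?U' borel (?D k'))"
        using M.cdf_holding_time[OF E posE] M'.cdf_holding_time[OF M'.state_in_history order_refl pos]
        by (auto simp: fun_eq_iff)
    qed
    have "(\<integral>\<^sup>+\<omega>\<in>E. ennreal (?D k \<omega>) \<partial>M) / emeasure M E = (\<integral>\<^sup>+\<omega>. ennreal (?D k \<omega>) \<partial>?U)"
      by (rule nn_integral_uniform_measure[symmetric]) measurable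
    also have "\<dots> = (\<integral>\<^sup>+x. ennreal x \<partial>distr ?U borel (?D k))"
      by (subst nn_integral_distr) auto
    also have "\<dots> = mean_holding_time M' X T k' s"
      unfolding eq mean_holding_time_def by (subst nn_integral_distr) auto
    finally have "(\<integral>\<^sup>+\<omega>\<in>E. ennreal (?D k \<omega>) \<partial>M) / emeasure M E * emeasure M E
        = mean_holding_time M' X T k' s * emeasure M E"
      by simp
    moreover have "emeasure M E / emeasure M E = 1"
      using E0 by (intro ennreal_divide_self) (auto simp: M.emeasure_eq_measure)
    ultimately show ?thesis by (metis ennreal_divide_times mult.right_neutral)
  qed
qed

subsection \<open>Expected costs up to a first visit\<close>

text \<open>\<open>K\<close> bounds the number of steps counted from time \<open>k\<close> on. The recursion peels off the first step
  instead of the last, so that the Markov renewal property applies at each level.\<close>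

primrec cost_until :: "(nat \<Rightarrow> 'a \<Rightarrow> nat) \<Rightarrow> nat \<Rightarrow> (nat \<Rightarrow> 'a \<Rightarrow> ennreal) \<Rightarrow> nat \<Rightarrow> nat \<Rightarrow> 'a \<Rightarrow> ennreal" where
  "cost_until X j f 0 k \<omega> = 0"
| "cost_until X j f (Suc K) k \<omega> =
     f k \<omega> + (if X (Suc k) \<omega> = j then 0 else cost_until X j f K (Suc k) \<omega>)"

text \<open>Value iteration for the first-step equations, computed from the matrix alone;
  \<open>c\<close> holds the mean one-step costs. In \<open>ennreal\<close> the limits exist before
  any bound is known.\<close>

primrec expected_cost ::
  "nat \<Rightarrow> (nat \<Rightarrow> nat \<Rightarrow> real) \<Rightarrow> nat \<Rightarrow> (nat \<Rightarrow> ennreal) \<Rightarrow> nat \<Rightarrow> nat \<Rightarrow> ennreal" where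
  "expected_cost N p j c 0 s = 0"
| "expected_cost N p j c (Suc K) s =
     c s + (\<Sum>l\<in>{1..N} - {j}. ennreal (p s l) * expected_cost N p j c K l)"

lemma cost_until_mono: "cost_until X j f K k \<omega> \<le> cost_until X j f (Suc K) k \<omega>"
proof (induction K arbitrary: k)
  case (Suc K)
  then show ?case by (auto intro!: add_left_mono simp del: cost_until.simps(2) simp: cost_until.simps(2)[of _ _ _ "Suc K"] cost_until.simps(2)[of _ _ _ K])
qed simp

lemma incseq_cost_until: "incseq (\<lambda>K. cost_until X j f K k \<omega>)"
  by (intro incseq_SucI cost_until_mono)

lemma incseq_expected_cost: "incseq (\<lambda>K. expected_cost N p j c K s)"
proof (intro incseq_SucI)
  show "expected_cost N p j c K s \<le> expected_cost N p j c (Suc K) s" for K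
  proof (induction K arbitrary: s)
    case (Suc K)
    show ?case
      unfolding expected_cost.simps(2)[of N p j c "Suc K"] expected_cost.simps(2)[of N p j c K]
      by (intro add_left_mono sum_mono mult_left_mono) (use Suc in auto)
  qed simp
qed

text \<open>The iterates increase, so their supremum is a limit, and the recursion passes to the
  limit term by term.\<close>

lemma SUP_expected_cost:
  "(SUP K. expected_cost N p j c K s)
    = c s + (\<Sum>l\<in>{1..N} - {j}. ennreal (p s l) * (SUP K. expected_cost N p j c K l))"
proof -
  have lim: "(\<lambda>K. expected_cost N p j c K l) \<longlonglongrightarrow> (SUP K. expected_cost N p j c K l)" for l
    by (rule LIMSEQ_SUP[OF incseq_expected_cost])
  have "(\<lambda>K. expected_cost N p j c (Suc K) s)
      \<longlonglongrightarrow> c s + (\<Sum>l\<in>{1..N} - {j}. ennreal (p s l) * (SUP K. expected_cost N p j c K l))"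
    unfolding expected_cost.simps(2)
    by (intro tendsto_intros tendsto_add tendsto_sum ennreal_tendsto_cmult lim) auto
  then show ?thesis
    using LIMSEQ_unique LIMSEQ_Suc[OF lim[of s]] by blast
qed

text \<open>The iteration starts at 0, below \<open>h\<close>; its step is monotone and fixes
  \<open>h\<close>.\<close>

lemma expected_cost_le:
  assumes "\<And>i. i \<in> {1..N} \<Longrightarrow> 0 \<le> h i"
    and "\<And>i k. i \<in> {1..N} \<Longrightarrow> k \<in> {1..N} \<Longrightarrow> 0 \<le> p i k"
    and "\<And>i. i \<in> {1..N} \<Longrightarrow> 0 \<le> c i"
    and "\<And>i. i \<in> {1..N} \<Longrightarrow> h i = c i + (\<Sum>k\<in>{1..N} - {j}. p i k * h k)"
    and "i \<in> {1..N}"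
  shows "expected_cost N p j (\<lambda>i. ennreal (c i)) K i \<le> ennreal (h i)"
  using assms(5)
proof (induction K arbitrary: i)
  case (Suc K)
  have "expected_cost N p j (\<lambda>i. ennreal (c i)) (Suc K) i
      \<le> ennreal (c i) + (\<Sum>l\<in>{1..N} - {j}. ennreal (p i l) * ennreal (h l))"
    unfolding expected_cost.simps(2)
    by (intro add_left_mono sum_mono mult_left_mono Suc.IH) auto
  also have "(\<Sum>l\<in>{1..N} - {j}. ennreal (p i l) * ennreal (h l))
      = (\<Sum>l\<in>{1..N} - {j}. ennreal (p i l * h l))"
    by (intro sum.cong) (use Suc.prems assms(1,2) in \<open>auto simp: ennreal_mult\<close>)
  also have "\<dots> = ennreal (\<Sum>l\<in>{1..N} - {j}. p i l * h l)"
    by (intro sum_ennreal mult_nonneg_nonneg) (use Suc.prems assms(1,2) in auto)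
  also have "ennreal (c i) + \<dots> = ennreal (c i + (\<Sum>l\<in>{1..N} - {j}. p i l * h l))"
    by (intro ennreal_plus[symmetric] sum_nonneg mult_nonneg_nonneg) (use Suc.prems assms(1-3) in auto)
  also have "\<dots> = ennreal (h i)"
    using assms(4)[OF Suc.prems] by presburger
  finally show ?case .
qed simp

text \<open>Off the target the matrix is transient, so the system has a nonnegative real solution,
  which bounds all iterates.\<close>

lemma expected_cost_bounded:
  assumes irr: "irreducible_matrix N p"
    and nonneg: "\<And>i k. i \<in> {1..N} \<Longrightarrow> k \<in> {1..N} \<Longrightarrow> 0 \<le> p i k"
    and row: "\<And>i. i \<in> {1..N} \<Longrightarrow> (\<Sum>k = 1..N. p i k) = 1"
    and c: "\<And>i. i \<in> {1..N} \<Longrightarrow> 0 \<le> c i"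
    and ij: "i \<in> {1..N}" "j \<in> {1..N}"
  shows "(SUP K. expected_cost N p j (\<lambda>i. ennreal (c i)) K i) < \<infinity>"
proof -
  let ?A = "{1..N} - {j}"
  have "drains ?A j p"
    using drains_irreducible[OF irr ij(2) nonneg row] by (intro drains_Diff_target) auto
  then have "\<exists>h. \<forall>i\<in>?A. 0 \<le> h i \<and> h i = c i + (\<Sum>k\<in>?A. p i k * h k)"
    by (intro drains_solution) (use c in auto)
  then obtain h where h0: "\<And>k. k \<in> ?A \<Longrightarrow> 0 \<le> h k"
    and h: "\<And>k. k \<in> ?A \<Longrightarrow> h k = c k + (\<Sum>l\<in>?A. p k l * h l)"
    by blast
  \<comment> \<open>Extends \<open>h\<close> to the target: the value at \<open>j\<close> occurs on
    no right-hand side, so its equation can serve as a definition.\<close>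
  define g where "g i = c i + (\<Sum>k\<in>?A. p i k * h k)" for i
  have gh: "g k = h k" if "k \<in> ?A" for k
    unfolding g_def by (rule h[OF that, symmetric])
  have "expected_cost N p j (\<lambda>i. ennreal (c i)) K i \<le> ennreal (g i)" for K
  proof (rule expected_cost_le[OF _ nonneg c _ ij(1)])
    show "0 \<le> g i" if "i \<in> {1..N}" for i
      unfolding g_def by (intro add_nonneg_nonneg sum_nonneg mult_nonneg_nonneg) (use that c nonneg h0 in auto)
    show "g i = c i + (\<Sum>k\<in>?A. p i k * g k)" if "i \<in> {1..N}" for i
    proof -
      have "(\<Sum>k\<in>?A. p i k * g k) = (\<Sum>k\<in>?A. p i k * h k)"
        by (rule sum.cong) (simp_all only: gh)
      then show ?thesis unfolding g_def by simp
    qed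
  qed
  then have "(SUP K. expected_cost N p j (\<lambda>i. ennreal (c i)) K i) \<le> ennreal (g i)"
    by (rule SUP_least)
  then show ?thesis by (rule le_less_trans) simp
qed

section \<open>Costs along a single path\<close>

lemma cost_until_no_visit:
  assumes "\<And>l. k < l \<Longrightarrow> X l \<omega> \<noteq> j"
  shows "cost_until X j (\<lambda>_ _. 1) K k \<omega> = of_nat K"
  using assms
proof (induction K arbitrary: k)
  case (Suc K)
  then show ?case using Suc.IH[of "Suc k"] Suc.prems[of "Suc k"] by simp
qed simp

text \<open>The increments telescope up to the visit at time \<open>k + Suc n\<close>, and the
  further \<open>K\<close> steps are free.\<close>

lemma cost_until_first_visit:
  fixes T :: "nat \<Rightarrow> 'a \<Rightarrow> real"
  assumes "\<And>l. T l \<omega> \<le> T (Suc l) \<omega>"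
    and "X (k + Suc n) \<omega> = j" and "\<And>l. k < l \<Longrightarrow> l < k + Suc n \<Longrightarrow> X l \<omega> \<noteq> j"
  shows "cost_until X j (\<lambda>l \<omega>. ennreal (T (Suc l) \<omega> - T l \<omega>)) (Suc n + K) k \<omega>
    = ennreal (T (k + Suc n) \<omega> - T k \<omega>)"
  using assms(2,3)
proof (induction n arbitrary: k)
  case 0
  then show ?case by simp
next
  case (Suc n)
  have le: "T l \<omega> \<le> T m \<omega>" if "l \<le> m" for l m
    using assms(1) that by (rule lift_Suc_mono_le)
  have "cost_until X j (\<lambda>l \<omega>. ennreal (T (Suc l) \<omega> - T l \<omega>)) (Suc n + K) (Suc k) \<omega>
      = ennreal (T (Suc k + Suc n) \<omega> - T (Suc k) \<omega>)"
    by (rule Suc.IH) (use Suc.prems in auto)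
  moreover have "X (Suc k) \<omega> \<noteq> j" using Suc.prems by auto
  ultimately have "cost_until X j (\<lambda>l \<omega>. ennreal (T (Suc l) \<omega> - T l \<omega>)) (Suc (Suc n) + K) k \<omega>
      = ennreal (T (Suc k) \<omega> - T k \<omega>) + ennreal (T (Suc k + Suc n) \<omega> - T (Suc k) \<omega>)"
    by simp
  also have "\<dots> = ennreal (T (k + Suc (Suc n)) \<omega> - T k \<omega>)"
    using le[of k "Suc k"] le[of "Suc k" "Suc k + Suc n"] by (subst ennreal_plus[symmetric]) auto
  finally show ?case .
qed

lemma first_passage_time_eq:
  fixes T :: "nat \<Rightarrow> 'a \<Rightarrow> real"
  assumes mono: "\<And>l. T l \<omega> \<le> T (Suc l) \<omega>" and "T 0 \<omega> = 0"
    and "k \<ge> 1" "X k \<omega> = j"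
  shows "first_passage_time X T j \<omega>
    = (SUP K. cost_until X j (\<lambda>l \<omega>. ennreal (T (Suc l) \<omega> - T l \<omega>)) K 0 \<omega>)"
proof -
  let ?C = "\<lambda>K. cost_until X j (\<lambda>l \<omega>. ennreal (T (Suc l) \<omega> - T l \<omega>)) K 0 \<omega>"
  define \<kappa> where "\<kappa> = (LEAST k. k \<ge> 1 \<and> X k \<omega> = j)"
  have \<kappa>: "\<kappa> \<ge> 1 \<and> X \<kappa> \<omega> = j"
    unfolding \<kappa>_def by (rule LeastI[of _ k]) (use assms in auto)
  have first: "X l \<omega> \<noteq> j" if "0 < l" "l < \<kappa>" for l
    using not_less_Least[of l "\<lambda>k. k \<ge> 1 \<and> X k \<omega> = j"] that unfolding \<kappa>_def by auto
  obtain n where n: "\<kappa> = Suc n" using \<kappa> by (cases \<kappa>) auto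
  have C: "?C (Suc n + K) = ennreal (T \<kappa> \<omega>)" for K
    using cost_until_first_visit[of T \<omega> X 0 n j K] mono \<kappa> first assms(2) n by simp
  \<comment> \<open>Index \<open>K\<close> lies below \<open>Suc n + K\<close>, where the cost has
    reached its final value.\<close>
  have "?C K \<le> ennreal (T \<kappa> \<omega>)" for K
    unfolding C[symmetric, of K] by (rule incseqD[OF incseq_cost_until]) simp
  moreover have "ennreal (T \<kappa> \<omega>) \<le> (SUP K. ?C K)"
    unfolding C[symmetric, of 0] by (rule SUP_upper) simp
  ultimately have "(SUP K. ?C K) = ennreal (T \<kappa> \<omega>)"
    by (intro antisym SUP_least)
  then show ?thesis
    using assms(3,4) unfolding first_passage_time_def \<kappa>_def by auto
qed

section \<open>Integrating path costs\<close>

context markov_renewal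
begin

lemma measurable_cost_until:
  assumes [measurable]: "\<And>k. f k \<in> borel_measurable M"
  shows "cost_until X j f K k \<in> borel_measurable M"
proof (induction K arbitrary: k)
  case (Suc K)
  note Suc [measurable]
  have "(\<lambda>\<omega>. f k \<omega> + (if X (Suc k) \<omega> = j then 0 else cost_until X j f K (Suc k) \<omega>)) \<in> borel_measurable M"
    by measurable
  then show ?case by (simp add: fun_eq_iff cong: measurable_cong)
qed (simp add: fun_eq_iff cong: measurable_cong)

text \<open>Ranging over all history events keeps the induction going: \<open>E\<close> cut down to
  a next state \<open>l\<close> is a history event at time \<open>Suc k\<close> ending in
  \<open>l\<close>.\<close>

lemma nn_integral_cost_until:
  assumes f [measurable]: "\<And>k. f k \<in> borel_measurable M"
    and p: "\<And>i k. i \<in> {1..N} \<Longrightarrow> k \<in> {1..N} \<Longrightarrow> 0 \<le> embedded_transition Q i k"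
    and c: "\<And>k s E. s \<in> {1..N} \<Longrightarrow> E \<in> sets (H k) \<Longrightarrow> E \<subseteq> {\<omega> \<in> space M. X k \<omega> = s} \<Longrightarrow>
      (\<integral>\<^sup>+\<omega>\<in>E. f k \<omega> \<partial>M) = c s * emeasure M E"
    and E: "s \<in> {1..N}" "E \<in> sets (H k)" "E \<subseteq> {\<omega> \<in> space M. X k \<omega> = s}"
  shows "(\<integral>\<^sup>+\<omega>\<in>E. cost_until X j f K k \<omega> \<partial>M)
    = expected_cost N (embedded_transition Q) j c K s * emeasure M E"
  using E
proof (induction K arbitrary: s E k)
  case (Suc K)
  have [measurable]: "E \<in> sets M" by (rule history_sets_M[OF Suc.prems(2)])
  note measurable_cost_until[OF f, measurable]
  let ?p = "embedded_transition Q"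
  let ?G = "cost_until X j f K (Suc k)"
  let ?E = "\<lambda>l. E \<inter> {\<omega> \<in> space M. X (Suc k) \<omega> = l}"
  have step: "(\<integral>\<^sup>+\<omega>\<in>?E l. ?G \<omega> \<partial>M) = ennreal (?p s l) * expected_cost N ?p j c K l * emeasure M E"
    if l: "l \<in> {1..N}" for l
  proof -
    have "emeasure M (?E l) = ennreal (?p s l) * emeasure M E"
      unfolding emeasure_eq_measure measure_transition[OF Suc.prems(2,3) l]
      by (rule ennreal_mult) (use p Suc.prems l in auto)
    then show ?thesis
      using Suc.IH[OF l history_step[OF Suc.prems(2)], of l] by (simp add: mult_ac)
  qed
  \<comment> \<open>Splits the remaining cost by the next state; at most one summand is
    nonzero.\<close>
  have "(if X (Suc k) \<omega> = j then 0 else ?G \<omega>) * indicator E \<omega>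
      = (\<Sum>l\<in>{1..N} - {j}. ?G \<omega> * indicator (?E l) \<omega>)" if \<omega>: "\<omega> \<in> space M" for \<omega>
  proof (cases "X (Suc k) \<omega> = j")
    case True
    then show ?thesis by (auto intro!: sum.neutral[symmetric])
  next
    case False
    have "(\<Sum>l\<in>{1..N} - {j}. ?G \<omega> * indicator (?E l) \<omega>)
        = (\<Sum>l\<in>{X (Suc k) \<omega>}. ?G \<omega> * indicator (?E l) \<omega>)"
      by (rule sum.mono_neutral_right) (use X_in_states[OF \<omega>] False in auto)
    then show ?thesis using False \<omega> by (simp add: indicator_def)
  qed
  then have "(\<integral>\<^sup>+\<omega>\<in>E. (if X (Suc k) \<omega> = j then 0 else ?G \<omega>) \<partial>M)
      = (\<integral>\<^sup>+\<omega>. (\<Sum>l\<in>{1..N} - {j}. ?G \<omega> * indicator (?E l) \<omega>) \<partial>M)"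
    by (intro nn_integral_cong)
  also have "\<dots> = (\<Sum>l\<in>{1..N} - {j}. \<integral>\<^sup>+\<omega>\<in>?E l. ?G \<omega> \<partial>M)"
    by (rule nn_integral_sum) measurable
  also have "\<dots> = (\<Sum>l\<in>{1..N} - {j}. ennreal (?p s l) * expected_cost N ?p j c K l) * emeasure M E"
    unfolding sum_distrib_right by (intro sum.cong step) auto
  finally have rest: "(\<integral>\<^sup>+\<omega>\<in>E. (if X (Suc k) \<omega> = j then 0 else ?G \<omega>) \<partial>M)
      = (\<Sum>l\<in>{1..N} - {j}. ennreal (?p s l) * expected_cost N ?p j c K l) * emeasure M E" .
  have "(\<integral>\<^sup>+\<omega>\<in>E. cost_until X j f (Suc K) k \<omega> \<partial>M)
      = (\<integral>\<^sup>+\<omega>\<in>E. f k \<omega> \<partial>M) + (\<integral>\<^sup>+\<omega>\<in>E. (if X (Suc k) \<omega> = j then 0 else ?G \<omega>) \<partial>M)"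
    unfolding cost_until.simps(2) distrib_right by (rule nn_integral_add) measurable
  then show ?case
    unfolding rest c[OF Suc.prems] by (simp add: distrib_right)
qed simp

lemma nn_integral_SUP_cost_until:
  assumes f: "\<And>k. f k \<in> borel_measurable M"
    and p: "\<And>i k. i \<in> {1..N} \<Longrightarrow> k \<in> {1..N} \<Longrightarrow> 0 \<le> embedded_transition Q i k"
    and c: "\<And>k s E. s \<in> {1..N} \<Longrightarrow> E \<in> sets (H k) \<Longrightarrow> E \<subseteq> {\<omega> \<in> space M. X k \<omega> = s} \<Longrightarrow>
      (\<integral>\<^sup>+\<omega>\<in>E. f k \<omega> \<partial>M) = c s * emeasure M E"
    and E: "s \<in> {1..N}" "E \<in> sets (H k)" "E \<subseteq> {\<omega> \<in> space M. X k \<omega> = s}"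
  shows "(\<integral>\<^sup>+\<omega>\<in>E. (SUP K. cost_until X j f K k \<omega>) \<partial>M)
    = (SUP K. expected_cost N (embedded_transition Q) j c K s) * emeasure M E"
proof -
  note measurable_cost_until[OF f, measurable] history_sets_M[OF E(2), measurable]
  have "(\<integral>\<^sup>+\<omega>\<in>E. (SUP K. cost_until X j f K k \<omega>) \<partial>M)
      = (\<integral>\<^sup>+\<omega>. (SUP K. cost_until X j f K k \<omega> * indicator E \<omega>) \<partial>M)"
    by (simp add: SUP_mult_right_ennreal)
  also have "\<dots> = (SUP K. \<integral>\<^sup>+\<omega>\<in>E. cost_until X j f K k \<omega> \<partial>M)"
    by (rule nn_integral_monotone_convergence_SUP)
      (auto intro!: incseq_SucI le_funI mult_right_mono cost_until_mono simp del: cost_until.simps)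
  also have "\<dots> = (SUP K. expected_cost N (embedded_transition Q) j c K s * emeasure M E)"
    by (intro arg_cong[where f = Sup] image_cong refl nn_integral_cost_until[OF f p c E])
  finally show ?thesis by (simp add: SUP_mult_right_ennreal)
qed

text \<open>With unit costs a path that misses \<open>j\<close> costs infinity, whereas the expected
  cost is finite.\<close>

lemma AE_visits:
  assumes irr: "irreducible_matrix N (embedded_transition Q)"
    and p: "\<And>i k. i \<in> {1..N} \<Longrightarrow> k \<in> {1..N} \<Longrightarrow> 0 \<le> embedded_transition Q i k"
    and row: "\<And>i. i \<in> {1..N} \<Longrightarrow> (\<Sum>k = 1..N. embedded_transition Q i k) = 1"
    and j: "j \<in> {1..N}"
  shows "AE \<omega> in M. X 0 \<omega> = i \<longrightarrow> (\<exists>k\<ge>1. X k \<omega> = j)"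
proof (cases "i \<in> {1..N}")
  case True
  let ?E = "{\<omega> \<in> space M. X 0 \<omega> = i}"
  let ?C = "\<lambda>\<omega>. SUP K. cost_until X j (\<lambda>_ _. 1) K 0 \<omega>"
  have E [measurable]: "?E \<in> sets M" by (rule history_sets_M[OF state_in_history])
  have [measurable]: "?C \<in> borel_measurable M"
    using measurable_cost_until[of "\<lambda>_ _. 1" j] by measurable
  have one: "(\<integral>\<^sup>+\<omega>\<in>E. 1 \<partial>M) = (\<lambda>_. ennreal 1) s * emeasure M E" if "E \<in> sets (H k)" for E k and s :: nat
    using history_sets_M[OF that] by simp
  have "(\<integral>\<^sup>+\<omega>\<in>?E. ?C \<omega> \<partial>M)
      = (SUP K. expected_cost N (embedded_transition Q) j (\<lambda>_. ennreal 1) K i) * emeasure M ?E"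
    by (rule nn_integral_SUP_cost_until[OF _ p one True state_in_history]) auto
  also have "\<dots> < \<infinity>"
    using expected_cost_bounded[OF irr p row _ True j, of "\<lambda>_. 1"]
    by (auto simp: ennreal_mult_less_top emeasure_eq_measure)
  finally have "AE \<omega> in M. ?C \<omega> * indicator ?E \<omega> \<noteq> \<infinity>"
    by (intro nn_integral_PInf_AE) auto
  then show ?thesis
  proof (rule AE_mp, intro AE_I2 impI)
    fix \<omega> assume \<omega>: "\<omega> \<in> space M" "?C \<omega> * indicator ?E \<omega> \<noteq> \<infinity>" "X 0 \<omega> = i"
    show "\<exists>k\<ge>1. X k \<omega> = j"
    proof (rule ccontr)
      assume "\<not> ?thesis"
      then have "?C \<omega> = (SUP K. of_nat K)"
        by (subst cost_until_no_visit) auto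
      then show False using \<omega> by (simp add: ennreal_SUP_of_nat_eq_top)
    qed
  qed
next
  case False
  then show ?thesis using X_in_states by (intro AE_I2) auto
qed

text \<open>Almost surely the passage time is the supremum of the stopped costs. Almost sure visits
  enter here: on a path missing \<open>j\<close> the passage time is infinite, but the accumulated
  holding times might not be.\<close>

lemma mean_first_passage_time_eq:
  assumes irr: "irreducible_matrix N (embedded_transition Q)"
    and p: "\<And>i k. i \<in> {1..N} \<Longrightarrow> k \<in> {1..N} \<Longrightarrow> 0 \<le> embedded_transition Q i k"
    and row: "\<And>i. i \<in> {1..N} \<Longrightarrow> (\<Sum>k = 1..N. embedded_transition Q i k) = 1"
    and c: "\<And>k s E. s \<in> {1..N} \<Longrightarrow> E \<in> sets (H k) \<Longrightarrow> E \<subseteq> {\<omega> \<in> space M. X k \<omega> = s} \<Longrightarrow>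
      (\<integral>\<^sup>+\<omega>\<in>E. ennreal (T (Suc k) \<omega> - T k \<omega>) \<partial>M) = c s * emeasure M E"
    and ij: "i \<in> {1..N}" "j \<in> {1..N}"
    and pos: "measure M {\<omega> \<in> space M. X 0 \<omega> = i} > 0"
  shows "mean_first_passage_time M X T i j
    = (SUP K. expected_cost N (embedded_transition Q) j c K i)"
proof -
  let ?E = "{\<omega> \<in> space M. X 0 \<omega> = i}"
  let ?f = "\<lambda>l \<omega>. ennreal (T (Suc l) \<omega> - T l \<omega>)"
  let ?C = "\<lambda>\<omega>. SUP K. cost_until X j ?f K 0 \<omega>"
  have E [measurable]: "?E \<in> sets M" by (rule history_sets_M[OF state_in_history])
  have E0: "emeasure M ?E \<noteq> 0" "emeasure M ?E < \<infinity>"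
    using pos by (auto simp: emeasure_eq_measure)
  have f [measurable]: "?f k \<in> borel_measurable M" for k by measurable
  have [measurable]: "?C \<in> borel_measurable M"
    using measurable_cost_until[of ?f j] by measurable
  have "AE \<omega> in M. \<forall>k. T k \<omega> \<le> T (Suc k) \<omega>" "AE \<omega> in M. T 0 \<omega> = 0"
    using mrp unfolding markov_renewal_process_def AE_all_countable by auto
  moreover have "AE \<omega> in M. X 0 \<omega> = i \<longrightarrow> (\<exists>k\<ge>1. X k \<omega> = j)"
    by (rule AE_visits[OF irr p row ij(2)])
  ultimately have "AE \<omega> in M. \<omega> \<in> ?E \<longrightarrow> first_passage_time X T j \<omega> = ?C \<omega>"
  proof eventually_elim
    case (elim \<omega>)
    then show ?case using first_passage_time_eq[of T \<omega> _ X j] by blast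
  qed
  then have "mean_first_passage_time M X T i j = (\<integral>\<^sup>+\<omega>. ?C \<omega> \<partial>uniform_measure M ?E)"
    unfolding mean_first_passage_time_def
    by (intro nn_integral_cong_AE AE_uniform_measureI[OF E])
  also have "\<dots> = (\<integral>\<^sup>+\<omega>\<in>?E. ?C \<omega> \<partial>M) / emeasure M ?E"
    by (rule nn_integral_uniform_measure) measurable
  also have "(\<integral>\<^sup>+\<omega>\<in>?E. ?C \<omega> \<partial>M) = (SUP K. expected_cost N (embedded_transition Q) j c K i) * emeasure M ?E"
    by (rule nn_integral_SUP_cost_until[OF f p c ij(1) state_in_history order_refl])
  also have "\<dots> / emeasure M ?E = (SUP K. expected_cost N (embedded_transition Q) j c K i)"
    using E0 by (intro ennreal_mult_divide_eq) auto
  finally show ?thesis .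
qed

end

subsection \<open>The first passage time recursion\<close>

text \<open>\<open>M i\<close> is a law charging the start \<open>i\<close>; all laws share
  \<open>Q\<close>, \<open>X\<close> and \<open>T\<close>. A single process whose initial
  distribution charges every state is the constant family.\<close>

theorem theorem7:
  fixes N :: nat
    and Q :: "nat \<Rightarrow> nat \<Rightarrow> real \<Rightarrow> real"
    and M :: "nat \<Rightarrow> 'a measure"
    and X :: "nat \<Rightarrow> 'a \<Rightarrow> nat"
    and T :: "nat \<Rightarrow> 'a \<Rightarrow> real"
    and p :: "nat \<Rightarrow> nat \<Rightarrow> real"
    and \<mu> :: "nat \<Rightarrow> real"
    and m :: "nat \<Rightarrow> nat \<Rightarrow> real"
  defines "p \<equiv> embedded_transition Q"
    and "\<mu> \<equiv> (\<lambda>i. enn2real (mean_holding_time (M i) X T 0 i))"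
    and "m \<equiv> (\<lambda>i j. enn2real (mean_first_passage_time (M i) X T i j))"
  assumes N: "N \<ge> 1"
    and mrp: "\<And>i. i \<in> {1..N} \<Longrightarrow> markov_renewal_process (M i) N Q X T"
    and init: "\<And>i. i \<in> {1..N} \<Longrightarrow> measure (M i) {\<omega> \<in> space (M i). X 0 \<omega> = i} > 0"
    and irred: "irreducible_matrix N p"
    and finite_mean: "\<And>i. i \<in> {1..N} \<Longrightarrow> mean_holding_time (M i) X T 0 i < \<infinity>"
  shows "(\<forall>i\<in>{1..N}. \<forall>j\<in>{1..N}. mean_first_passage_time (M i) X T i j < \<infinity>)
    \<and> ((\<forall>i\<in>{3..N}. \<forall>j\<in>{1..i - 1}.
           m i j = (red_mu p \<mu> N i i + (\<Sum>k\<in>{1..i - 1} - {j}. red_p p N i i k * m k j)) / red_S p N i)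
       \<and> (2 \<le> N \<longrightarrow> m 2 1 = red_mu p \<mu> N 2 2 / red_S p N 2))
    \<and> ((\<forall>i\<in>{2..N}. m i i = red_mu p \<mu> N i i + (\<Sum>k = 1..i - 1. red_p p N i i k * m k i))
       \<and> m 1 1 = red_mu p \<mu> N 1 1)
    \<and> ((\<forall>i\<in>{2..N - 1}. \<forall>j\<in>{i + 1..N}.
           m i j = (red_nu p \<mu> N i j i + (\<Sum>k = 1..i - 1. red_q p N i j i k * m k j)) / red_R p N i j)
       \<and> (\<forall>j\<in>{2..N}. m 1 j = red_nu p \<mu> N 1 j 1 / red_R p N 1 j))"
proof -
  let ?S = "{1..N}"
  have ren: "markov_renewal (M i) N Q X T" if "i \<in> ?S" for i
    using mrp[OF that] by (rule markov_renewal.intro)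
  have p0: "0 \<le> p i k" if "i \<in> ?S" "k \<in> ?S" for i k
    unfolding p_def
    by (rule markov_renewal.embedded_transition_nonneg[OF ren init]) (use that in auto)
  have row: "(\<Sum>k = 1..N. p i k) = 1" if "i \<in> ?S" for i
    unfolding p_def
    by (rule markov_renewal.embedded_transition_row[OF ren init]) (use that in auto)
  have mu0: "0 \<le> \<mu> i" for i by (simp add: \<mu>_def)
  let ?V = "\<lambda>j i. SUP K. expected_cost N p j (\<lambda>s. ennreal (\<mu> s)) K i"
  have V: "mean_first_passage_time (M i) X T i j = ?V j i" if ij: "i \<in> ?S" "j \<in> ?S" for i j
    unfolding p_def
  proof (rule markov_renewal.mean_first_passage_time_eq[OF ren[OF ij(1)]])
    show "(\<integral>\<^sup>+\<omega>\<in>E. ennreal (T (Suc k) \<omega> - T k \<omega>) \<partial>M i) = ennreal (\<mu> s) * emeasure (M i) E"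
      if "s \<in> ?S" "E \<in> sets (mrp_history (M i) N X T k)" "E \<subseteq> {\<omega> \<in> space (M i). X k \<omega> = s}" for k s E
    proof -
      \<comment> \<open>Finiteness of the mean makes the conversion by \<open>enn2real\<close>
        lossless; the value is then carried from \<open>M s\<close> to \<open>M i\<close>.\<close>
      have "ennreal (\<mu> s) = mean_holding_time (M s) X T 0 s"
        unfolding \<mu>_def using finite_mean[OF that(1)] by simp
      then show ?thesis
        using mean_holding_time_unique[OF ren[OF ij(1)] ren[OF that(1)] that(2,3) init[OF that(1)]]
        by simp
    qed
  qed (use irred p0 row init ij in \<open>auto simp: p_def\<close>)
  have fin: "?V j i < \<infinity>" if "i \<in> ?S" "j \<in> ?S" for i j
    by (rule expected_cost_bounded[OF irred p0 row mu0]) (use that in auto)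
  have m: "ennreal (m i j) = ?V j i" if "i \<in> ?S" "j \<in> ?S" for i j
    unfolding m_def V[OF that] using fin[OF that] by simp
  have m0: "0 \<le> m i j" for i j by (simp add: m_def)
  \<comment> \<open>The fixed-point equation of the supremum, brought from \<open>ennreal\<close> to
    the reals by finiteness and nonnegativity.\<close>
  have first_step: "m i j = \<mu> i + (\<Sum>k\<in>?S - {j}. p i k * m k j)" if ij: "i \<in> ?S" "j \<in> ?S" for i j
  proof -
    have "ennreal (m i j) = ennreal (\<mu> i) + (\<Sum>k\<in>?S - {j}. ennreal (p i k) * ?V j k)"
      unfolding m[OF ij] by (rule SUP_expected_cost)
    also have "(\<Sum>k\<in>?S - {j}. ennreal (p i k) * ?V j k) = (\<Sum>k\<in>?S - {j}. ennreal (p i k * m k j))"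
    proof (rule sum.cong)
      show "ennreal (p i k) * ?V j k = ennreal (p i k * m k j)" if "k \<in> ?S - {j}" for k
        using m[of k j] that ij p0[of i k] m0[of k j] by (simp add: ennreal_mult)
    qed simp
    also have "\<dots> = ennreal (\<Sum>k\<in>?S - {j}. p i k * m k j)"
      by (rule sum_ennreal) (use ij p0 m0 in auto)
    also have "ennreal (\<mu> i) + \<dots> = ennreal (\<mu> i + (\<Sum>k\<in>?S - {j}. p i k * m k j))"
      by (rule ennreal_plus[symmetric]) (use ij p0 m0 mu0 in \<open>auto intro!: sum_nonneg mult_nonneg_nonneg\<close>)
    finally show ?thesis
      by (subst (asm) ennreal_inj) (use ij p0 m0 mu0 in \<open>auto intro!: add_nonneg_nonneg sum_nonneg mult_nonneg_nonneg\<close>)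
  qed
  have red: "m i j = red_mu p \<mu> N n i + (\<Sum>k\<in>{1..n} - {j}. red_p p N n i k * m k j)"
    if "n \<le> N" "j \<in> {1..n}" "i \<in> {1..n}" for i j n
    by (rule red_p_first_step[OF irred p0 row first_step that]) (use that in auto)
  \<comment> \<open>At level \<open>i\<close> the state \<open>i\<close> is the last one; moving its
    own term to the left produces the factor \<open>red_S p N i\<close>.\<close>
  have lower: "m i j = (red_mu p \<mu> N i i + (\<Sum>k\<in>{1..i - 1} - {j}. red_p p N i i k * m k j)) / red_S p N i"
    if i: "2 \<le> i" "i \<le> N" and j: "j \<in> {1..i - 1}" for i j
  proof -
    have eq: "{1..i} - {j} = insert i ({1..i - 1} - {j})" using i j by auto
    have "m i j = red_mu p \<mu> N i i + (\<Sum>k\<in>{1..i} - {j}. red_p p N i i k * m k j)"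
      by (rule red) (use i j in auto)
    also have "(\<Sum>k\<in>{1..i} - {j}. red_p p N i i k * m k j)
        = red_p p N i i i * m i j + (\<Sum>k\<in>{1..i - 1} - {j}. red_p p N i i k * m k j)"
      unfolding eq by (rule sum.insert) (use i in auto)
    finally have "m i j * (1 - red_p p N i i i)
        = red_mu p \<mu> N i i + (\<Sum>k\<in>{1..i - 1} - {j}. red_p p N i i k * m k j)"
      by (simp add: algebra_simps)
    moreover have "red_S p N i = 1 - red_p p N i i i"
      by (rule red_S_eq(1)[OF irred p0 row i(2,1)])
    moreover have "red_p p N i i i < 1"
      by (rule red_S_eq(2)[OF irred p0 row i(2,1)])
    ultimately show ?thesis by (simp add: nonzero_eq_divide_eq)
  qed
  \<comment> \<open>At level \<open>i\<close> the target is the last state and drops out of the sum,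
    so nothing has to be divided.\<close>
  have diag: "m i i = red_mu p \<mu> N i i + (\<Sum>k = 1..i - 1. red_p p N i i k * m k i)"
    if i: "1 \<le> i" "i \<le> N" for i
  proof -
    have "{1..i} - {i} = {1..i - 1}" using i by auto
    then show ?thesis using red[of i i i] i by simp
  qed
  \<comment> \<open>\<open>red_p\<close> stops at level \<open>j\<close>, where the target is last;
    \<open>red_q\<close> then eliminates down to \<open>i\<close>, and the term at \<open>i\<close>
    gives \<open>red_R\<close>.\<close>
  have upper: "m i j = (red_nu p \<mu> N i j i + (\<Sum>k = 1..i - 1. red_q p N i j i k * m k j)) / red_R p N i j"
    if i: "1 \<le> i" "i < j" and j: "j \<le> N" for i j
  proof -
    have dr: "drains {1..j} j (red_p p N j)"
      by (rule red_p_drains[OF irred p0 row j]) (use i in auto)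
    have eq: "{1..i} = insert i {1..i - 1}" using i by auto
    have "m i j = red_nu p \<mu> N i j i + (\<Sum>k = 1..i. red_q p N i j i k * m k j)"
      by (rule red_q_first_step[OF dr red[OF j]]) (use i in auto)
    also have "(\<Sum>k = 1..i. red_q p N i j i k * m k j)
        = red_q p N i j i i * m i j + (\<Sum>k = 1..i - 1. red_q p N i j i k * m k j)"
      unfolding eq by (rule sum.insert) (use i in auto)
    finally have "m i j = red_nu p \<mu> N i j i
        + (red_q p N i j i i * m i j + (\<Sum>k = 1..i - 1. red_q p N i j i k * m k j))" .
    moreover have "red_q p N i j i i < 1"
      by (rule drains_diag[OF red_q_drains[OF dr, of i]]) (use i in auto)
    ultimately show ?thesis by (simp add: red_R_def field_simps)
  qed
  show ?thesis
  proof (intro conjI ballI impI)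
    show "mean_first_passage_time (M i) X T i j < \<infinity>" if "i \<in> ?S" "j \<in> ?S" for i j
      using V[OF that] fin[OF that] by simp
    show "m i j = (red_mu p \<mu> N i i + (\<Sum>k\<in>{1..i - 1} - {j}. red_p p N i i k * m k j)) / red_S p N i"
      if "i \<in> {3..N}" "j \<in> {1..i - 1}" for i j
      by (rule lower) (use that in auto)
    \<comment> \<open>For \<open>i = 2\<close> and \<open>j = 1\<close> the index set of the sum is
      empty.\<close>
    show "m 2 1 = red_mu p \<mu> N 2 2 / red_S p N 2" if "2 \<le> N"
      using lower[of 2 1] that by simp
    show "m i i = red_mu p \<mu> N i i + (\<Sum>k = 1..i - 1. red_p p N i i k * m k i)" if "i \<in> {2..N}" for i
      by (rule diag) (use that in auto)
    show "m 1 1 = red_mu p \<mu> N 1 1"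
      using diag[of 1] N by simp
    show "m i j = (red_nu p \<mu> N i j i + (\<Sum>k = 1..i - 1. red_q p N i j i k * m k j)) / red_R p N i j"
      if "i \<in> {2..N - 1}" "j \<in> {i + 1..N}" for i j
      by (rule upper) (use that in auto)
    show "m 1 j = red_nu p \<mu> N 1 j 1 / red_R p N 1 j" if "j \<in> {2..N}" for j
      using upper[of 1 j] that by simp
  qed
qed

end
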